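(* For a single block $B$, let $\tilde{\boldsymbol{u}}(t)$ satisfy the semidiscretization $$\tilde{\boldsymbol{\rho}}\tilde{\boldsymbol{H}}\ddot{\tilde{\boldsymbol{u}}}=-\sum_{i,j=1}^d\tilde{\boldsymbol{A}}_{ij}^{(\hat C_{ij})}\tilde{\boldsymbol{u}}+\sum_{f=1}^{2d}(\bar{\boldsymbol{L}}^f)^T\boldsymbol{H}^f\hat{\boldsymbol{\tau}}^{*f}-\sum_{f=1}^{2d}\sum_{i,j=1}^d(\bar{\boldsymbol{B}}_j^f)^T\hat n_i^f\hat{\boldsymbol{C}}_{ij}^f\boldsymbol{H}^f\big(\boldsymbol{u}^{*f}-\boldsymbol{u}^f\big),\qquad \boldsymbol{u}^f=\bar{\boldsymbol{L}}^f\tilde{\boldsymbol{u}},$$ for arbitrary numerical flux vectors $\hat{\boldsymbol{\tau}}^{*f}(t)$ and (time-differentiable) $\boldsymbol{u}^{*f}(t)$. Let $$\mathcal{E}^B=\frac12\dot{\tilde{\boldsymbol{u}}}^T\tilde{\boldsymbol{H}}\tilde{\boldsymbol{\rho}}\,\dot{\tilde{\boldsymbol{u}}}+\frac12\sum_{i,j}\tilde{\boldsymbol{u}}^T\tilde{\boldsymbol{A}}_{ij}^{(\hat C_{ij})}\tilde{\boldsymbol{u}}+\frac12\sum_{f=1}^{2d}\Big((\hat{\boldsymbol{\tau}}^f)^T(\boldsymbol{X}^f)^{-1}\boldsymbol{H}^f\hat{\boldsymbol{\tau}}^f-(\hat{\boldsymbol{T}}^f)^T(\boldsymbol{X}^f)^{-1}\boldsymbol{H}^f\hat{\boldsymbol{T}}^f\Big),$$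 $$\hat{\boldsymbol{T}}^f=\sum_{i,j}\hat n_i^f\hat{\boldsymbol{C}}_{ij}^f\bar{\boldsymbol{B}}_j^f\tilde{\boldsymbol{u}},\qquad \hat{\boldsymbol{\tau}}^f=\hat{\boldsymbol{T}}^f+\boldsymbol{X}^f(\boldsymbol{u}^{*f}-\boldsymbol{u}^f),\qquad \boldsymbol{X}^f=\sum_{i,j}\hat n_i^f\hat n_j^f\hat{\boldsymbol{C}}_{ij}^f\boldsymbol{\Gamma}^f,$$ with $\boldsymbol{\Gamma}^f$ diagonal with positive entries. Then $$\dot{\mathcal{E}}^B=\sum_{f=1}^{2d}\dot{\mathcal{E}}^f,\qquad \dot{\mathcal{E}}^f=(\hat{\boldsymbol{\tau}}^{*f})^T\boldsymbol{H}^f\dot{\boldsymbol{u}}^f+(\hat{\boldsymbol{\tau}}^f)^T\boldsymbol{H}^f\big(\dot{\boldsymbol{u}}^{*f}-\dot{\boldsymbol{u}}^f\big).$$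
   Context: One-dimensional summation-by-parts operators on grid points $0,\dots,N$ ($N\ge1$; $\boldsymbol{e}_k$ the $k$-th grid basis vector): $\boldsymbol{H}$ is diagonal positive definite; $\boldsymbol{D}_1=\boldsymbol{H}^{-1}\boldsymbol{Q}$ with $\boldsymbol{Q}+\boldsymbol{Q}^T=\boldsymbol{e}_N\boldsymbol{e}_N^T-\boldsymbol{e}_0\boldsymbol{e}_0^T$; $\boldsymbol{b}_0,\boldsymbol{b}_N$ are boundary derivative vectors; for each positive coefficient grid function $C$, $\boldsymbol{A}_{11}^{(C)}$ is symmetric positive semidefinite (the SBP second derivative operator $\boldsymbol{D}_{11}^{(C)}\approx\partial_1C\partial_1$ satisfies $\boldsymbol{H}\boldsymbol{D}_{11}^{(C)}=-\boldsymbol{A}_{11}^{(C)}+C_N\boldsymbol{e}_N\boldsymbol{b}_N^T-C_0\boldsymbol{e}_0\boldsymbol{b}_0^T$). Multidimensional operators on $[0,1]^d$ with a tensor product grid ($N_i+1$ points in direction $i$): $\tilde{\boldsymbol{H}}$ is the (diagonal) tensor product of the one-dimensional $\boldsymbol{H}$'s; $\tilde{\boldsymbol{D}}_i$ applies $\boldsymbol{D}_1$ along direction $i$. Faces $f=1,\dots,2d$: faces $2i-1$ and $2i$ are $\xi_i=0$ and $\xi_i=1$; $\hat n_i^f=(-1)^f$ if $i=\lceil f/2\rceil$ and $0$ otherwise. $\bar{\boldsymbol{L}}^f$ restricts a grid function to face $f$; $\boldsymbol{H}^f$ is the diagonal tensor product of the one-dimensional $\boldsymbol{H}$'s of the directions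 tangential to face $f$. $\bar{\boldsymbol{B}}_j^f$: if $j=\lceil f/2\rceil$, apply $\boldsymbol{b}_0^T$ ($f$ odd) or $\boldsymbol{b}_N^T$ ($f$ even) along direction $j$; if $j\neq\lceil f/2\rceil$, $\bar{\boldsymbol{B}}_j^f=\bar{\boldsymbol{L}}^f\tilde{\boldsymbol{D}}_j$. For a coefficient grid function $C$ with diagonal matrix $\tilde{\boldsymbol{C}}$: for $i\ne j$, $\tilde{\boldsymbol{A}}_{ij}^{(C)}=\tilde{\boldsymbol{D}}_i^T\tilde{\boldsymbol{C}}\tilde{\boldsymbol{H}}\tilde{\boldsymbol{D}}_j$; for $i=j$, $\tilde{\boldsymbol{A}}_{ii}^{(C)}$ is the sum over all grid lines in direction $i$ of $\boldsymbol{A}_{11}^{(C\text{ on the line})}$ acting on that line, weighted by the product of the diagonal $\boldsymbol{H}$ entries of the other directions. Coefficients (time independent): at every grid point $(\hat C_{ij})_{i,j=1}^d$ is symmetric positive definite; $\hat{\boldsymbol{C}}_{ij}^f$ is the diagonal matrix of values of $\hat C_{ij}$ at the points of face $f$; $\tilde{\boldsymbol{\rho}}$ is the diagonal matrix of positive density values. Dots denote time derivatives; $\dot{\mathcal{E}}^f$ is the notation for the energy face rate of change defined by the displayed formula. *)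

theory Defs
  imports "HOL-Analysis.Analysis"
begin

section \<open>Matrices over finite index sets\<close>

text \<open>
  The number of directions and the number of grid points per direction are arbitrary and occur
  inside the statement, so vectors and matrices are real-valued functions of one and two indices,
  and each operation carries the finite index set it ranges over. Values outside these index sets
  are irrelevant.
\<close>

definition mv :: "'b set \<Rightarrow> ('a \<Rightarrow> 'b \<Rightarrow> real) \<Rightarrow> ('b \<Rightarrow> real) \<Rightarrow> 'a \<Rightarrow> real" where
  "mv J M x = (\<lambda>p. \<Sum>q\<in>J. M p q * x q)"

definition mm :: "'b set \<Rightarrow> ('a \<Rightarrow> 'b \<Rightarrow> real) \<Rightarrow> ('b \<Rightarrow> 'c \<Rightarrow> real) \<Rightarrow> 'a \<Rightarrow> 'c \<Rightarrow> real" where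
  "mm J M K = (\<lambda>p r. \<Sum>q\<in>J. M p q * K q r)"

definition dot :: "'a set \<Rightarrow> ('a \<Rightarrow> real) \<Rightarrow> ('a \<Rightarrow> real) \<Rightarrow> real" where
  "dot I x y = (\<Sum>p\<in>I. x p * y p)"

definition tr :: "('a \<Rightarrow> 'b \<Rightarrow> real) \<Rightarrow> 'b \<Rightarrow> 'a \<Rightarrow> real" where
  "tr M = (\<lambda>p q. M q p)"

definition diag :: "('a \<Rightarrow> real) \<Rightarrow> 'a \<Rightarrow> 'a \<Rightarrow> real" where
  "diag c = (\<lambda>p q. if p = q then c p else 0)"

definition idm :: "'a \<Rightarrow> 'a \<Rightarrow> real" where
  "idm = diag (\<lambda>_. 1)"

definition outer :: "('a \<Rightarrow> real) \<Rightarrow> ('b \<Rightarrow> real) \<Rightarrow> 'a \<Rightarrow> 'b \<Rightarrow> real" where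
  "outer x y = (\<lambda>p q. x p * y q)"

definition unit_vec :: "'a \<Rightarrow> 'a \<Rightarrow> real" where
  "unit_vec k = (\<lambda>l. if l = k then 1 else 0)"

definition mat_inverse :: "'a set \<Rightarrow> ('a \<Rightarrow> 'a \<Rightarrow> real) \<Rightarrow> 'a \<Rightarrow> 'a \<Rightarrow> real" where
  "mat_inverse I M =
     (SOME K. \<forall>p\<in>I. \<forall>q\<in>I. mm I M K p q = idm p q \<and> mm I K M p q = idm p q)"

definition is_diagonal :: "'a set \<Rightarrow> ('a \<Rightarrow> 'a \<Rightarrow> real) \<Rightarrow> bool" where
  "is_diagonal I M \<longleftrightarrow> (\<forall>p\<in>I. \<forall>q\<in>I. p \<noteq> q \<longrightarrow> M p q = 0)"

definition is_symmetric :: "'a set \<Rightarrow> ('a \<Rightarrow> 'a \<Rightarrow> real) \<Rightarrow> bool" where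
  "is_symmetric I M \<longleftrightarrow> (\<forall>p\<in>I. \<forall>q\<in>I. M p q = M q p)"

definition pos_semidefinite :: "'a set \<Rightarrow> ('a \<Rightarrow> 'a \<Rightarrow> real) \<Rightarrow> bool" where
  "pos_semidefinite I M \<longleftrightarrow> (\<forall>x. 0 \<le> dot I x (mv I M x))"

definition pos_definite :: "'a set \<Rightarrow> ('a \<Rightarrow> 'a \<Rightarrow> real) \<Rightarrow> bool" where
  "pos_definite I M \<longleftrightarrow> (\<forall>x. (\<exists>p\<in>I. x p \<noteq> 0) \<longrightarrow> 0 < dot I x (mv I M x))"


section \<open>One-dimensional SBP operators\<close>

text \<open>
  The grid is \<open>{0..npts}\<close>. Coefficient grid functions are taken extensional, that is,
  elements of \<open>{0..npts} \<rightarrow>\<^sub>E {0<..}\<close>, so that the operators can only depend on grid values.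
\<close>

record sbp_ops =
  npts :: nat
  opH :: "nat \<Rightarrow> nat \<Rightarrow> real"
  opQ :: "nat \<Rightarrow> nat \<Rightarrow> real"
  b_left :: "nat \<Rightarrow> real"
  b_right :: "nat \<Rightarrow> real"
  opA11 :: "(nat \<Rightarrow> real) \<Rightarrow> nat \<Rightarrow> nat \<Rightarrow> real"
  opD11 :: "(nat \<Rightarrow> real) \<Rightarrow> nat \<Rightarrow> nat \<Rightarrow> real"

definition opD1 :: "sbp_ops \<Rightarrow> nat \<Rightarrow> nat \<Rightarrow> real" where
  "opD1 S = mm {0..npts S} (mat_inverse {0..npts S} (opH S)) (opQ S)"

definition sbp_operators :: "sbp_ops \<Rightarrow> bool" where
  "sbp_operators S \<longleftrightarrow> (let N = npts S; I = {0..N} in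
     1 \<le> N \<and>
     is_diagonal I (opH S) \<and> pos_definite I (opH S) \<and>
     (\<forall>k\<in>I. \<forall>l\<in>I. opQ S k l + tr (opQ S) k l =
        outer (unit_vec N) (unit_vec N) k l - outer (unit_vec 0) (unit_vec 0) k l) \<and>
     (\<forall>c \<in> I \<rightarrow>\<^sub>E {0<..}.
        is_symmetric I (opA11 S c) \<and> pos_semidefinite I (opA11 S c) \<and>
        (\<forall>k\<in>I. \<forall>l\<in>I. mm I (opH S) (opD11 S c) k l =
           - opA11 S c k l + c N * outer (unit_vec N) (b_right S) k l
             - c 0 * outer (unit_vec 0) (b_left S) k l)))"


section \<open>A single block\<close>

text \<open>
  A grid point is a multi-index, i.e. an extensional function on the set \<open>{1..bdim}\<close> of
  directions. A point of a face is a multi-index over the directions tangential to it.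
  Each direction has its own one-dimensional operators, since the numbers of points differ.
\<close>

type_synonym point = "nat \<Rightarrow> nat"

record block =
  bdim :: nat
  ops :: "nat \<Rightarrow> sbp_ops"
  coeff :: "nat \<Rightarrow> nat \<Rightarrow> point \<Rightarrow> real"
  dens :: "point \<Rightarrow> real"
  gam :: "nat \<Rightarrow> point \<Rightarrow> real"

definition dirs :: "block \<Rightarrow> nat set" where
  "dirs B = {1..bdim B}"

definition faces :: "block \<Rightarrow> nat set" where
  "faces B = {1..2 * bdim B}"

definition grid_over :: "block \<Rightarrow> nat set \<Rightarrow> point set" where
  "grid_over B S = (\<Pi>\<^sub>E i\<in>S. {0..npts (ops B i)})"

definition grid :: "block \<Rightarrow> point set" where
  "grid B = grid_over B (dirs B)"

definition face_dir :: "nat \<Rightarrow> nat" where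
  "face_dir f = nat \<lceil>real f / 2\<rceil>"

definition face :: "block \<Rightarrow> nat \<Rightarrow> point set" where
  "face B f = grid_over B (dirs B - {face_dir f})"

definition nhat :: "nat \<Rightarrow> nat \<Rightarrow> real" where
  "nhat i f = (if i = face_dir f then (-1) ^ f else 0)"

text \<open>Entries of the tensor product of the matrices \<open>M i\<close>, \<open>i \<in> S\<close>.\<close>

definition tensor :: "nat set \<Rightarrow> (nat \<Rightarrow> nat \<Rightarrow> nat \<Rightarrow> real) \<Rightarrow> point \<Rightarrow> point \<Rightarrow> real" where
  "tensor S M = (\<lambda>p q. \<Prod>i\<in>S. M i (p i) (q i))"

text \<open>The one-dimensional row vector \<open>v\<close> applied along direction \<open>j\<close>, i.e. the tensor product
  of \<open>v\<^sup>T\<close> in direction \<open>j\<close> with identities in the other directions.\<close>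

definition row_along :: "block \<Rightarrow> nat \<Rightarrow> (nat \<Rightarrow> real) \<Rightarrow> point \<Rightarrow> point \<Rightarrow> real" where
  "row_along B j v = (\<lambda>q p. v (p j) * tensor (dirs B - {j}) (\<lambda>_. idm) q p)"

definition Ht :: "block \<Rightarrow> point \<Rightarrow> point \<Rightarrow> real" where
  "Ht B = tensor (dirs B) (\<lambda>i. opH (ops B i))"

definition Hf :: "block \<Rightarrow> nat \<Rightarrow> point \<Rightarrow> point \<Rightarrow> real" where
  "Hf B f = tensor (dirs B - {face_dir f}) (\<lambda>i. opH (ops B i))"

definition Dt :: "block \<Rightarrow> nat \<Rightarrow> point \<Rightarrow> point \<Rightarrow> real" where
  "Dt B i = tensor (dirs B) (\<lambda>k. if k = i then opD1 (ops B k) else idm)"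

definition face_index :: "block \<Rightarrow> nat \<Rightarrow> nat" where
  "face_index B f = (if odd f then 0 else npts (ops B (face_dir f)))"

definition Lf :: "block \<Rightarrow> nat \<Rightarrow> point \<Rightarrow> point \<Rightarrow> real" where
  "Lf B f = row_along B (face_dir f) (unit_vec (face_index B f))"

definition Bf :: "block \<Rightarrow> nat \<Rightarrow> nat \<Rightarrow> point \<Rightarrow> point \<Rightarrow> real" where
  "Bf B j f =
     (if j = face_dir f
      then row_along B j (if odd f then b_left (ops B j) else b_right (ops B j))
      else mm (grid B) (Lf B f) (Dt B j))"

text \<open>For \<open>i = j\<close>, the sum runs over the grid lines in direction \<open>i\<close>, each given by its
  multi-index \<open>l\<close> in the other directions; the condition says that \<open>p\<close> and \<open>q\<close> lie on the line.\<close>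

definition At :: "block \<Rightarrow> nat \<Rightarrow> nat \<Rightarrow> (point \<Rightarrow> real) \<Rightarrow> point \<Rightarrow> point \<Rightarrow> real" where
  "At B i j c =
     (if i \<noteq> j
      then mm (grid B) (tr (Dt B i))
             (mm (grid B) (diag c) (mm (grid B) (Ht B) (Dt B j)))
      else (\<lambda>p q. \<Sum>l\<in>grid_over B (dirs B - {i}).
              (\<Prod>k\<in>dirs B - {i}. opH (ops B k) (l k) (l k)) *
              (if \<forall>k\<in>dirs B - {i}. p k = l k \<and> q k = l k
               then opA11 (ops B i) (\<lambda>m\<in>{0..npts (ops B i)}. c (l(i := m))) (p i) (q i)
               else 0)))"

definition Cf :: "block \<Rightarrow> nat \<Rightarrow> nat \<Rightarrow> nat \<Rightarrow> point \<Rightarrow> point \<Rightarrow> real" where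
  "Cf B f i j = diag (\<lambda>q. coeff B i j (q(face_dir f := face_index B f)))"

definition Rho :: "block \<Rightarrow> point \<Rightarrow> point \<Rightarrow> real" where
  "Rho B = diag (dens B)"

definition Xf :: "block \<Rightarrow> nat \<Rightarrow> point \<Rightarrow> point \<Rightarrow> real" where
  "Xf B f = (\<lambda>q r. \<Sum>i\<in>dirs B. \<Sum>j\<in>dirs B.
     nhat i f * nhat j f * mm (face B f) (Cf B f i j) (diag (gam B f)) q r)"

definition valid_block :: "block \<Rightarrow> bool" where
  "valid_block B \<longleftrightarrow>
     1 \<le> bdim B \<and>
     (\<forall>i\<in>dirs B. sbp_operators (ops B i)) \<and>
     (\<forall>p\<in>grid B. is_symmetric (dirs B) (\<lambda>i j. coeff B i j p) \<and>
                  pos_definite (dirs B) (\<lambda>i j. coeff B i j p)) \<and>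
     (\<forall>p\<in>grid B. 0 < dens B p) \<and>
     (\<forall>f\<in>faces B. \<forall>q\<in>face B f. 0 < gam B f q)"


section \<open>Semidiscretization and energy\<close>

text \<open>In this section all arguments are values at one time: \<open>u\<close>, \<open>du\<close>, \<open>ddu\<close> are the
  displacement and its first two time derivatives; \<open>taus f\<close>, \<open>us f\<close>, \<open>dus f\<close> are the numerical
  fluxes on face \<open>f\<close> and the time derivative of the latter one.\<close>

definition uf :: "block \<Rightarrow> nat \<Rightarrow> (point \<Rightarrow> real) \<Rightarrow> point \<Rightarrow> real" where
  "uf B f u = mv (grid B) (Lf B f) u"

definition semidiscretization ::
  "block \<Rightarrow> (point \<Rightarrow> real) \<Rightarrow> (point \<Rightarrow> real) \<Rightarrow> (nat \<Rightarrow> point \<Rightarrow> real) \<Rightarrow>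
    (nat \<Rightarrow> point \<Rightarrow> real) \<Rightarrow> bool" where
  "semidiscretization B u ddu taus us \<longleftrightarrow> (\<forall>p\<in>grid B.
     mv (grid B) (mm (grid B) (Rho B) (Ht B)) ddu p =
       - (\<Sum>i\<in>dirs B. \<Sum>j\<in>dirs B. mv (grid B) (At B i j (coeff B i j)) u p)
       + (\<Sum>f\<in>faces B. mv (face B f) (tr (Lf B f)) (mv (face B f) (Hf B f) (taus f)) p)
       - (\<Sum>f\<in>faces B. \<Sum>i\<in>dirs B. \<Sum>j\<in>dirs B.
            mv (face B f) (tr (Bf B j f))
              (\<lambda>q. nhat i f *
                 mv (face B f) (mm (face B f) (Cf B f i j) (Hf B f))
                    (\<lambda>r. us f r - uf B f u r) q) p))"

definition That :: "block \<Rightarrow> nat \<Rightarrow> (point \<Rightarrow> real) \<Rightarrow> point \<Rightarrow> real" where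
  "That B f u = (\<lambda>q. \<Sum>i\<in>dirs B. \<Sum>j\<in>dirs B.
     nhat i f * mv (face B f) (Cf B f i j) (mv (grid B) (Bf B j f) u) q)"

definition tauhat ::
  "block \<Rightarrow> nat \<Rightarrow> (point \<Rightarrow> real) \<Rightarrow> (nat \<Rightarrow> point \<Rightarrow> real) \<Rightarrow> point \<Rightarrow> real" where
  "tauhat B f u us = (\<lambda>q. That B f u q + mv (face B f) (Xf B f) (\<lambda>r. us f r - uf B f u r) q)"

definition block_energy ::
  "block \<Rightarrow> (point \<Rightarrow> real) \<Rightarrow> (point \<Rightarrow> real) \<Rightarrow> (nat \<Rightarrow> point \<Rightarrow> real) \<Rightarrow> real" where
  "block_energy B u du us =
     1/2 * dot (grid B) du (mv (grid B) (mm (grid B) (Ht B) (Rho B)) du)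
     + 1/2 * (\<Sum>i\<in>dirs B. \<Sum>j\<in>dirs B.
         dot (grid B) u (mv (grid B) (At B i j (coeff B i j)) u))
     + 1/2 * (\<Sum>f\<in>faces B.
         let XinvH = mm (face B f) (mat_inverse (face B f) (Xf B f)) (Hf B f);
             \<tau> = tauhat B f u us; T = That B f u
         in dot (face B f) \<tau> (mv (face B f) XinvH \<tau>)
            - dot (face B f) T (mv (face B f) XinvH T))"

text \<open>\<open>Lf\<close> is constant in time, so the time derivative of \<open>uf B f u\<close> is \<open>uf B f du\<close>.\<close>

definition face_energy_rate ::
  "block \<Rightarrow> nat \<Rightarrow> (point \<Rightarrow> real) \<Rightarrow> (point \<Rightarrow> real) \<Rightarrow> (nat \<Rightarrow> point \<Rightarrow> real) \<Rightarrow>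
    (nat \<Rightarrow> point \<Rightarrow> real) \<Rightarrow> (nat \<Rightarrow> point \<Rightarrow> real) \<Rightarrow> real" where
  "face_energy_rate B f u du taus us dus =
     dot (face B f) (taus f) (mv (face B f) (Hf B f) (uf B f du))
     + dot (face B f) (tauhat B f u us)
         (mv (face B f) (Hf B f) (\<lambda>q. dus f q - uf B f du q))"

end

theory Submission
  imports Defs
begin

text \<open>
  Every operator weighting a sum over the grid or over a face is diagonal there, so the only
  matrices with genuine off-diagonal structure are the stiffness matrix
  \<open>S = \<Sum>\<^sub>i\<^sub>j A\<^sub>i\<^sub>j\<close> and the boundary operators \<open>L\<^sup>f\<close>, \<open>B\<^sub>j\<^sup>f\<close>.

  The stiffness matrix is symmetric: exchanging \<open>i\<close> and \<open>j\<close> transposes the mixed blocks because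
  \<open>C\<^sub>i\<^sub>j = C\<^sub>j\<^sub>i\<close>, and the diagonal blocks inherit the symmetry of the one-dimensional
  \<open>A\<^sub>1\<^sub>1\<close>, which applies since \<open>C\<^sub>i\<^sub>i > 0\<close> (lemma \<open>At_transpose\<close>). Hence kinetic and bulk
  elastic energy change at the rate of the semidiscretization tested with \<open>u'\<close>
  (lemma \<open>semidiscretization_weak_form\<close>), where each boundary operator moves by transposition
  from the equation to the test vector. What remains are the work of \<open>\<tau>\<^sup>*\<close> and, with
  \<open>w = u\<^sup>* - u\<close>, the terms \<open>- T(u')\<^sup>T H w\<close> on each face.

  The face part of the energy cancels these. Since \<open>X\<close> is diagonal with positive entries and
  \<open>\<tau> = T + X w\<close>, the difference of squares contains no inverse any more:
  \<open>1/2 (\<tau>\<^sup>T X\<^sup>-\<^sup>1 H \<tau> - T\<^sup>T X\<^sup>-\<^sup>1 H T) = T\<^sup>T H w + 1/2 w\<^sup>T X H w\<close>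
  (lemma \<open>face_energy_eq\<close>). Its derivative is \<open>T(u')\<^sup>T H w + (T + X w)\<^sup>T H w'\<close>, whose first
  term is the one to be cancelled and whose second term is \<open>\<tau>\<^sup>T H w'\<close>, as required.
\<close>

section \<open>Diagonal and transposed matrices\<close>

lemma mv_diagonal:
  assumes "finite I" "is_diagonal I M" "p \<in> I"
  shows "mv I M x p = M p p * x p"
proof -
  have "mv I M x p = (\<Sum>q\<in>I. if q = p then M p p * x p else 0)"
    unfolding mv_def using assms by (intro sum.cong) (auto simp: is_diagonal_def)
  then show ?thesis using assms by simp
qed

lemma mm_diagonal_left:
  assumes "finite I" "is_diagonal I M" "p \<in> I"
  shows "mm I M K p r = M p p * K p r"
  using mv_diagonal[OF assms, of "\<lambda>q. K q r"] by (simp add: mv_def mm_def)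

lemma is_diagonal_diag [simp]: "is_diagonal I (diag c)"
  by (simp add: is_diagonal_def diag_def)

lemma is_diagonal_mm:
  assumes "finite I" "is_diagonal I M" "is_diagonal I K"
  shows "is_diagonal I (mm I M K)"
  using assms by (auto simp: is_diagonal_def mm_diagonal_left)

text \<open>The inverse is chosen among all matrices that are inverse on \<open>I\<close>; on a diagonal matrix the
  equations on \<open>I\<close> leave only one candidate for the entries there.\<close>

lemma mat_inverse_diagonal:
  assumes "finite I" "is_diagonal I M" "\<And>p. p \<in> I \<Longrightarrow> M p p \<noteq> 0" "p \<in> I" "q \<in> I"
  shows "mat_inverse I M p q = (if p = q then inverse (M p p) else 0)"
proof -
  let ?inv = "\<lambda>K. \<forall>p\<in>I. \<forall>q\<in>I. mm I M K p q = idm p q \<and> mm I K M p q = idm p q"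
  have "?inv (diag (\<lambda>p. inverse (M p p)))"
  proof (intro ballI)
    fix p q assume pq: "p \<in> I" "q \<in> I"
    let ?D = "diag (\<lambda>p. inverse (M p p))"
    have "mm I M ?D p q = M p p * ?D p q" "mm I ?D M p q = ?D p p * M p q"
      using pq assms(1,2) by (auto intro: mm_diagonal_left)
    then show "mm I M ?D p q = idm p q \<and> mm I ?D M p q = idm p q"
      using pq assms(2,3) by (auto simp: idm_def diag_def is_diagonal_def)
  qed
  then have "?inv (mat_inverse I M)"
    unfolding mat_inverse_def by (rule someI[where P = ?inv])
  then have "M p p * mat_inverse I M p q = idm p q"
    using assms(4,5) mm_diagonal_left[OF assms(1,2,4), of "mat_inverse I M" q] by metis
  then show ?thesis
    using assms(3)[OF assms(4)] inverse_unique[of "M p p" "mat_inverse I M p q"]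
    by (cases "p = q") (simp_all add: idm_def diag_def)
qed

lemma dot_sum_right:
  "dot I x (\<lambda>p. \<Sum>k\<in>K. y k p) = (\<Sum>k\<in>K. dot I x (y k))"
  unfolding dot_def sum_distrib_left by (rule sum.swap)

lemma dot_mv_transpose:
  "dot I x (mv J (tr M) y) = dot J (mv I M x) y"
  unfolding dot_def mv_def tr_def sum_distrib_left sum_distrib_right
  by (subst sum.swap) (simp add: algebra_simps)

lemma dot_mv_symmetric:
  assumes "is_symmetric I M"
  shows "dot I x (mv I M y) = dot I y (mv I M x)"
proof -
  have "dot I x (mv I M y) = dot I x (mv I (tr M) y)"
    using assms unfolding dot_def mv_def tr_def is_symmetric_def
    by (intro sum.cong refl arg_cong2[of _ _ _ _ "(*)"]) auto
  also have "\<dots> = dot I y (mv I M x)"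
    by (simp add: dot_mv_transpose) (simp add: dot_def mult.commute)
  finally show ?thesis .
qed

section \<open>Derivatives of linear and quadratic expressions\<close>

lemma DERIV_mv:
  assumes "\<And>q. q \<in> J \<Longrightarrow> ((\<lambda>s. x s q) has_real_derivative x' q) (at t within T)"
  shows "((\<lambda>s. mv J M (x s) p) has_real_derivative mv J M x' p) (at t within T)"
  unfolding mv_def by (rule DERIV_sum, rule DERIV_cmult, rule assms)

lemma DERIV_quadratic_form:
  assumes "\<And>p. p \<in> I \<Longrightarrow> ((\<lambda>s. x s p) has_real_derivative x' p) (at t within T)"
    and "is_symmetric I M"
  shows "((\<lambda>s. 1/2 * dot I (x s) (mv I M (x s))) has_real_derivative
           dot I x' (mv I M (x t))) (at t within T)"
proof -
  have "((\<lambda>s. 1/2 * dot I (x s) (mv I M (x s))) has_real_derivative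
           1/2 * (\<Sum>p\<in>I. x' p * mv I M (x t) p + mv I M x' p * x t p)) (at t within T)"
    unfolding dot_def
  proof (rule DERIV_cmult, rule DERIV_sum)
    fix p assume "p \<in> I"
    then show "((\<lambda>s. x s p * mv I M (x s) p) has_real_derivative
        x' p * mv I M (x t) p + mv I M x' p * x t p) (at t within T)"
      by (rule DERIV_mult[OF assms(1) DERIV_mv[OF assms(1)]])
  qed
  also have "1/2 * (\<Sum>p\<in>I. x' p * mv I M (x t) p + mv I M x' p * x t p)
      = 1/2 * (dot I x' (mv I M (x t)) + dot I (x t) (mv I M x'))"
    by (simp add: dot_def sum.distrib mult.commute)
  also have "\<dots> = dot I x' (mv I M (x t))"
    using dot_mv_symmetric[OF assms(2), of "x t" x'] by simp
  finally show ?thesis .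
qed

section \<open>Norms and coefficients on the tensor product grid\<close>

lemma finite_grid_over [simp]: "finite S \<Longrightarrow> finite (grid_over B S)"
  by (simp add: grid_over_def finite_PiE)

lemma finite_dirs [simp]: "finite (dirs B)"
  by (simp add: dirs_def)

lemma finite_grid [simp]: "finite (grid B)"
  by (simp add: grid_def)

lemma finite_face [simp]: "finite (face B f)"
  by (simp add: face_def)

lemma face_dir_in_dirs:
  assumes "f \<in> faces B"
  shows "face_dir f \<in> dirs B"
proof -
  have "1 \<le> f" "f \<le> 2 * bdim B" using assms by (auto simp: faces_def)
  then have "1 \<le> \<lceil>real f / 2\<rceil>" "\<lceil>real f / 2\<rceil> \<le> int (bdim B)"
    by (auto simp: le_ceiling_iff ceiling_le_iff mult.commute)
  then show ?thesis
    unfolding face_dir_def dirs_def atLeastAtMost_iff by linarith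
qed

lemma grid_over_insert_point:
  assumes "l \<in> grid_over B (S - {i})" "i \<in> S" "m \<le> npts (ops B i)"
  shows "l(i := m) \<in> grid_over B S"
  using assms by (auto simp: grid_over_def PiE_iff extensional_def)

text \<open>Two distinct extensional multi-indices differ in some direction of \<open>S\<close>, where the
  corresponding factor of the tensor product vanishes.\<close>

lemma is_diagonal_tensor:
  assumes "finite S" "\<And>i. i \<in> S \<Longrightarrow> is_diagonal {0..npts (ops B i)} (M i)"
  shows "is_diagonal (grid_over B S) (tensor S M)"
  unfolding is_diagonal_def
proof (intro ballI impI)
  fix p q assume p: "p \<in> grid_over B S" and q: "q \<in> grid_over B S" and "p \<noteq> q"
  then obtain i where i: "i \<in> S" "p i \<noteq> q i"
    unfolding grid_over_def by (metis PiE_ext)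
  moreover have "p i \<in> {0..npts (ops B i)}" "q i \<in> {0..npts (ops B i)}"
    using p q i by (auto simp: grid_over_def PiE_iff)
  ultimately have "M i (p i) (q i) = 0"
    using assms(2)[of i] unfolding is_diagonal_def by blast
  then show "tensor S M p q = 0"
    using i assms(1) by (auto simp: tensor_def)
qed

lemma is_diagonal_opH:
  assumes "valid_block B" "i \<in> dirs B"
  shows "is_diagonal {0..npts (ops B i)} (opH (ops B i))"
  using assms by (auto simp: valid_block_def sbp_operators_def Let_def)

lemma is_diagonal_Ht: "valid_block B \<Longrightarrow> is_diagonal (grid B) (Ht B)"
  unfolding grid_def Ht_def by (intro is_diagonal_tensor) (auto intro: is_diagonal_opH)

lemma is_diagonal_Hf: "valid_block B \<Longrightarrow> is_diagonal (face B f) (Hf B f)"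
  unfolding face_def Hf_def by (intro is_diagonal_tensor) (auto intro: is_diagonal_opH)

lemma coeff_symmetric:
  "\<lbrakk>valid_block B; p \<in> grid B; i \<in> dirs B; j \<in> dirs B\<rbrakk> \<Longrightarrow> coeff B i j p = coeff B j i p"
  by (auto simp: valid_block_def is_symmetric_def)

lemma coeff_diagonal_pos:
  assumes "valid_block B" "p \<in> grid B" "i \<in> dirs B"
  shows "0 < coeff B i i p"
proof -
  have "pos_definite (dirs B) (\<lambda>i j. coeff B i j p)"
    using assms by (auto simp: valid_block_def)
  then have "0 < dot (dirs B) (unit_vec i) (mv (dirs B) (\<lambda>i j. coeff B i j p) (unit_vec i))"
    using assms(3) by (auto simp: pos_definite_def unit_vec_def)
  also have "\<dots> = coeff B i i p"
    using assms(3)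
    by (simp add: dot_def mv_def unit_vec_def if_distrib if_distribR cong: if_cong)
  finally show ?thesis .
qed

section \<open>Symmetry of the stiffness matrix\<close>

text \<open>The positivity of \<open>C\<^sub>i\<^sub>i\<close> enters because the one-dimensional operators are known to be
  symmetric for positive coefficients only. In the mixed case both sides are
  \<open>\<Sum>\<^sub>r D\<^sub>i(r,p) C\<^sub>i\<^sub>j(r) H(r,r) D\<^sub>j(r,q)\<close>.\<close>

lemma At_transpose:
  assumes B: "valid_block B" and dirs: "i \<in> dirs B" "j \<in> dirs B"
    and p: "p \<in> grid B" and q: "q \<in> grid B"
  shows "At B i j (coeff B i j) p q = At B j i (coeff B j i) q p"
proof (cases "i = j")
  case False
  have mixed: "At B a b (coeff B a b) p q =
      (\<Sum>r\<in>grid B. Dt B a r p * (coeff B a b r * (Ht B r r * Dt B b r q)))"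
    if "a \<noteq> b" for a b p q
  proof -
    have "At B a b (coeff B a b) p q = (\<Sum>r\<in>grid B. tr (Dt B a) p r *
        mm (grid B) (diag (coeff B a b)) (mm (grid B) (Ht B) (Dt B b)) r q)"
      using that by (simp add: At_def mm_def[of "grid B" "tr (Dt B a)"])
    then show ?thesis
      by (simp add: mm_diagonal_left is_diagonal_Ht[OF B] tr_def) (simp add: diag_def)
  qed
  show ?thesis
    unfolding mixed[OF False] mixed[OF False[symmetric]]
    using coeff_symmetric[OF B _ dirs] by (intro sum.cong refl) simp
next
  case True
  have sym: "opA11 (ops B i) (\<lambda>m\<in>{0..npts (ops B i)}. coeff B i i (l(i := m))) (p i) (q i) =
      opA11 (ops B i) (\<lambda>m\<in>{0..npts (ops B i)}. coeff B i i (l(i := m))) (q i) (p i)"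
    if l: "l \<in> grid_over B (dirs B - {i})" for l
  proof -
    have "(\<lambda>m\<in>{0..npts (ops B i)}. coeff B i i (l(i := m))) \<in> {0..npts (ops B i)} \<rightarrow>\<^sub>E {0<..}"
      using grid_over_insert_point[OF l dirs(1)] coeff_diagonal_pos[OF B _ dirs(1)]
      by (auto simp: grid_def)
    moreover have "sbp_operators (ops B i)"
      using B dirs by (auto simp: valid_block_def)
    moreover have "p i \<in> {0..npts (ops B i)}" "q i \<in> {0..npts (ops B i)}"
      using p q dirs by (auto simp: grid_def grid_over_def PiE_iff)
    ultimately show ?thesis
      unfolding sbp_operators_def Let_def is_symmetric_def by blast
  qed
  show ?thesis
    unfolding True[symmetric] At_def using sym by (auto intro!: sum.cong)
qed

definition stiffness :: "block \<Rightarrow> point \<Rightarrow> point \<Rightarrow> real" where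
  "stiffness B = (\<lambda>p q. \<Sum>i\<in>dirs B. \<Sum>j\<in>dirs B. At B i j (coeff B i j) p q)"

lemma is_symmetric_stiffness:
  assumes "valid_block B"
  shows "is_symmetric (grid B) (stiffness B)"
  unfolding is_symmetric_def
proof (intro ballI)
  fix p q assume "p \<in> grid B" "q \<in> grid B"
  then have "stiffness B p q = (\<Sum>i\<in>dirs B. \<Sum>j\<in>dirs B. At B j i (coeff B j i) q p)"
    unfolding stiffness_def using At_transpose[OF assms] by (intro sum.cong refl) auto
  also have "\<dots> = stiffness B q p"
    unfolding stiffness_def by (rule sum.swap)
  finally show "stiffness B p q = stiffness B q p" .
qed

lemma mv_stiffness:
  "mv (grid B) (stiffness B) x =
     (\<lambda>p. \<Sum>i\<in>dirs B. \<Sum>j\<in>dirs B. mv (grid B) (At B i j (coeff B i j)) x p)"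
proof
  fix p
  have "mv (grid B) (stiffness B) x p =
      (\<Sum>q\<in>grid B. \<Sum>i\<in>dirs B. \<Sum>j\<in>dirs B. At B i j (coeff B i j) p q * x q)"
    by (simp add: mv_def stiffness_def sum_distrib_right)
  also have "\<dots> = (\<Sum>i\<in>dirs B. \<Sum>q\<in>grid B. \<Sum>j\<in>dirs B. At B i j (coeff B i j) p q * x q)"
    by (rule sum.swap)
  also have "\<dots> = (\<Sum>i\<in>dirs B. \<Sum>j\<in>dirs B. \<Sum>q\<in>grid B. At B i j (coeff B i j) p q * x q)"
    by (intro sum.cong refl sum.swap)
  finally show "mv (grid B) (stiffness B) x p =
     (\<Sum>i\<in>dirs B. \<Sum>j\<in>dirs B. mv (grid B) (At B i j (coeff B i j)) x p)"
    by (simp add: mv_def)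
qed

lemma dot_mv_stiffness:
  "dot (grid B) x (mv (grid B) (stiffness B) y) =
     (\<Sum>i\<in>dirs B. \<Sum>j\<in>dirs B. dot (grid B) x (mv (grid B) (At B i j (coeff B i j)) y))"
  by (simp add: mv_stiffness dot_sum_right)

lemma is_diagonal_mass: "valid_block B \<Longrightarrow> is_diagonal (grid B) (mm (grid B) (Ht B) (Rho B))"
  by (intro is_diagonal_mm) (auto simp: is_diagonal_Ht Rho_def)

lemma mass_commute:
  assumes "valid_block B" "p \<in> grid B"
  shows "mv (grid B) (mm (grid B) (Ht B) (Rho B)) x p
       = mv (grid B) (mm (grid B) (Rho B) (Ht B)) x p"
proof -
  have "is_diagonal (grid B) (Rho B)" by (simp add: Rho_def)
  then show ?thesis
    using assms by (simp add: mv_diagonal mm_diagonal_left is_diagonal_mm is_diagonal_Ht)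
qed

section \<open>The semidiscretization tested with a grid function\<close>

lemma dot_uf:
  "dot (grid B) v (mv (face B f) (tr (Lf B f)) (mv (face B f) (Hf B f) y))
     = dot (face B f) y (mv (face B f) (Hf B f) (uf B f v))" if "valid_block B"
  unfolding dot_mv_transpose uf_def unfolding dot_def using that
  by (auto intro!: sum.cong simp: mv_diagonal is_diagonal_Hf)

text \<open>Tested with \<open>v\<close>, the penalty on the displacement jump \<open>w\<close> is the discrete traction of
  \<open>v\<close> paired with \<open>w\<close>: the penalty is built from the transposes of the operators in \<open>That\<close>,
  and the diagonal matrices in between commute.\<close>

lemma dot_That:
  assumes "valid_block B"
  shows "(\<Sum>i\<in>dirs B. \<Sum>j\<in>dirs B. dot (grid B) v (mv (face B f) (tr (Bf B j f))
            (\<lambda>q. nhat i f * mv (face B f) (mm (face B f) (Cf B f i j) (Hf B f)) w q)))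
     = dot (face B f) (That B f v) (mv (face B f) (Hf B f) w)"
proof -
  have diagC: "is_diagonal (face B f) (Cf B f i j)" for i j
    by (simp add: Cf_def)
  have "dot (face B f) (That B f v) (mv (face B f) (Hf B f) w)
      = (\<Sum>q\<in>face B f. \<Sum>i\<in>dirs B. \<Sum>j\<in>dirs B. nhat i f *
           (Cf B f i j q q * mv (grid B) (Bf B j f) v q) * (Hf B f q q * w q))"
    unfolding dot_def That_def sum_distrib_right
    by (intro sum.cong refl) (simp add: mv_diagonal diagC is_diagonal_Hf[OF assms])
  also have "\<dots> = (\<Sum>i\<in>dirs B. \<Sum>q\<in>face B f. \<Sum>j\<in>dirs B. nhat i f *
           (Cf B f i j q q * mv (grid B) (Bf B j f) v q) * (Hf B f q q * w q))"
    by (rule sum.swap)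
  also have "\<dots> = (\<Sum>i\<in>dirs B. \<Sum>j\<in>dirs B. \<Sum>q\<in>face B f. nhat i f *
           (Cf B f i j q q * mv (grid B) (Bf B j f) v q) * (Hf B f q q * w q))"
    by (intro sum.cong refl sum.swap)
  also have "\<dots> = (\<Sum>i\<in>dirs B. \<Sum>j\<in>dirs B. dot (grid B) v (mv (face B f) (tr (Bf B j f))
            (\<lambda>q. nhat i f * mv (face B f) (mm (face B f) (Cf B f i j) (Hf B f)) w q)))"
    unfolding dot_mv_transpose unfolding dot_def
    by (intro sum.cong refl)
       (simp add: mv_diagonal mm_diagonal_left is_diagonal_mm diagC is_diagonal_Hf[OF assms])
  finally show ?thesis ..
qed

lemma semidiscretization_weak_form:
  assumes B: "valid_block B" and semi: "semidiscretization B u ddu taus us"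
  shows "dot (grid B) v (mv (grid B) (mm (grid B) (Ht B) (Rho B)) ddu)
       + dot (grid B) v (mv (grid B) (stiffness B) u)
       + (\<Sum>f\<in>faces B. dot (face B f) (That B f v)
            (mv (face B f) (Hf B f) (\<lambda>r. us f r - uf B f u r)))
     = (\<Sum>f\<in>faces B. dot (face B f) (taus f) (mv (face B f) (Hf B f) (uf B f v)))"
proof -
  define K where "K = mv (grid B) (stiffness B) u"
  define flux where "flux f = mv (face B f) (tr (Lf B f)) (mv (face B f) (Hf B f) (taus f))" for f
  define penalty where "penalty f i j = mv (face B f) (tr (Bf B j f))
      (\<lambda>q. nhat i f * mv (face B f) (mm (face B f) (Cf B f i j) (Hf B f))
                    (\<lambda>r. us f r - uf B f u r) q)" for f i j
  have "dot (grid B) v (mv (grid B) (mm (grid B) (Ht B) (Rho B)) ddu)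
      = dot (grid B) v (\<lambda>p. - K p + (\<Sum>f\<in>faces B. flux f p)
          - (\<Sum>f\<in>faces B. \<Sum>i\<in>dirs B. \<Sum>j\<in>dirs B. penalty f i j p))"
    unfolding dot_def
  proof (intro sum.cong refl arg_cong2[of _ _ _ _ "(*)"])
    fix p assume "p \<in> grid B"
    then show "mv (grid B) (mm (grid B) (Ht B) (Rho B)) ddu p = - K p + (\<Sum>f\<in>faces B. flux f p)
          - (\<Sum>f\<in>faces B. \<Sum>i\<in>dirs B. \<Sum>j\<in>dirs B. penalty f i j p)"
      using semi mass_commute[OF B]
      by (simp add: semidiscretization_def K_def flux_def penalty_def mv_stiffness)
  qed
  also have "\<dots> = - dot (grid B) v K + dot (grid B) v (\<lambda>p. \<Sum>f\<in>faces B. flux f p)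
      - dot (grid B) v (\<lambda>p. \<Sum>f\<in>faces B. \<Sum>i\<in>dirs B. \<Sum>j\<in>dirs B. penalty f i j p)"
    by (simp add: dot_def algebra_simps sum.distrib sum_subtractf sum_negf)
  also have "dot (grid B) v (\<lambda>p. \<Sum>f\<in>faces B. \<Sum>i\<in>dirs B. \<Sum>j\<in>dirs B. penalty f i j p)
      = (\<Sum>f\<in>faces B. dot (face B f) (That B f v)
            (mv (face B f) (Hf B f) (\<lambda>r. us f r - uf B f u r)))"
    unfolding dot_sum_right penalty_def dot_That[OF B] ..
  also have "dot (grid B) v (\<lambda>p. \<Sum>f\<in>faces B. flux f p)
      = (\<Sum>f\<in>faces B. dot (face B f) (taus f) (mv (face B f) (Hf B f) (uf B f v)))"
    unfolding dot_sum_right flux_def dot_uf[OF B] ..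
  finally show ?thesis by (simp add: K_def)
qed

section \<open>The face part of the energy\<close>

text \<open>Only the normal direction \<open>k\<close> contributes to \<open>Xf\<close>, where the signs square to one, so
  the diagonal entry is \<open>C\<^sub>k\<^sub>k \<Gamma>\<close>.\<close>

lemma Xf_entry:
  assumes "f \<in> faces B" "q \<in> face B f" "r \<in> face B f"
  defines "k \<equiv> face_dir f"
  shows "Xf B f q r = (if q = r then coeff B k k (q(k := face_index B f)) * gam B f q else 0)"
proof -
  have "Xf B f q r = (\<Sum>i\<in>dirs B. \<Sum>j\<in>dirs B. if i = k \<and> j = k
      then mm (face B f) (Cf B f k k) (diag (gam B f)) q r else 0)"
    unfolding Xf_def by (intro sum.cong refl) (auto simp: nhat_def k_def simp flip: power_add)
  also have "\<dots> = (\<Sum>i\<in>dirs B. if i = k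
      then (\<Sum>j\<in>dirs B. if j = k then mm (face B f) (Cf B f k k) (diag (gam B f)) q r else 0)
      else 0)"
    by (intro sum.cong refl) auto
  also have "\<dots> = mm (face B f) (Cf B f k k) (diag (gam B f)) q r"
    using face_dir_in_dirs[OF assms(1)] by (simp add: k_def)
  also have "\<dots> = Cf B f k k q q * diag (gam B f) q r"
    using assms(2) by (intro mm_diagonal_left) (auto simp: Cf_def)
  finally show ?thesis by (simp add: Cf_def diag_def k_def)
qed

lemma is_diagonal_Xf: "f \<in> faces B \<Longrightarrow> is_diagonal (face B f) (Xf B f)"
  by (auto simp: is_diagonal_def Xf_entry)

lemma Xf_pos:
  assumes "valid_block B" "f \<in> faces B" "q \<in> face B f"
  shows "0 < Xf B f q q"
proof -
  have "q(face_dir f := face_index B f) \<in> grid B"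
    unfolding grid_def using assms(3) face_dir_in_dirs[OF assms(2)]
    by (intro grid_over_insert_point) (auto simp: face_def face_index_def)
  moreover have "0 < gam B f q"
    using assms by (auto simp: valid_block_def)
  ultimately show ?thesis
    using coeff_diagonal_pos[OF assms(1) _ face_dir_in_dirs[OF assms(2)]] assms
    by (simp add: Xf_entry)
qed

lemma tauhat_eq:
  assumes "f \<in> faces B" "q \<in> face B f"
  shows "tauhat B f u us q = That B f u q + Xf B f q q * (us f q - uf B f u q)"
  using assms by (simp add: tauhat_def mv_diagonal is_diagonal_Xf)

text \<open>Pointwise, \<open>x\<^sup>-\<^sup>1 ((T + x w)\<^sup>2 - T\<^sup>2) = 2 T w + x w\<^sup>2\<close>.\<close>

lemma face_energy_eq:
  assumes B: "valid_block B" and f: "f \<in> faces B"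
  defines "XinvH \<equiv> mm (face B f) (mat_inverse (face B f) (Xf B f)) (Hf B f)"
  shows "dot (face B f) (tauhat B f u us) (mv (face B f) XinvH (tauhat B f u us))
       - dot (face B f) (That B f u) (mv (face B f) XinvH (That B f u))
     = (\<Sum>q\<in>face B f. Hf B f q q * (2 * (That B f u q * (us f q - uf B f u q))
          + Xf B f q q * (us f q - uf B f u q)\<^sup>2))"
proof -
  have nz: "Xf B f q q \<noteq> 0" if "q \<in> face B f" for q
    using Xf_pos[OF B f that] by simp
  note inv = mat_inverse_diagonal[OF finite_face is_diagonal_Xf[OF f] nz]
  have diag_inv: "is_diagonal (face B f) (mat_inverse (face B f) (Xf B f))"
    by (simp add: is_diagonal_def inv)
  have XinvH: "mv (face B f) XinvH x q = inverse (Xf B f q q) * Hf B f q q * x q"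
    if "q \<in> face B f" for x q
    using that unfolding XinvH_def
    by (simp add: mv_diagonal mm_diagonal_left is_diagonal_mm diag_inv is_diagonal_Hf[OF B] inv)
  show ?thesis
    unfolding dot_def sum_subtractf[symmetric]
  proof (intro sum.cong refl)
    fix q assume q: "q \<in> face B f"
    show "tauhat B f u us q * mv (face B f) XinvH (tauhat B f u us) q
        - That B f u q * mv (face B f) XinvH (That B f u) q
      = Hf B f q q * (2 * (That B f u q * (us f q - uf B f u q))
          + Xf B f q q * (us f q - uf B f u q)\<^sup>2)"
      unfolding XinvH[OF q] tauhat_eq[OF f q]
      using nz[OF q] by (simp add: field_simps power2_eq_square)
  qed
qed

lemma DERIV_uf:
  assumes "\<And>p. p \<in> grid B \<Longrightarrow> ((\<lambda>s. u s p) has_real_derivative u' p) (at t within T)"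
  shows "((\<lambda>s. uf B f (u s) q) has_real_derivative uf B f u' q) (at t within T)"
  unfolding uf_def by (rule DERIV_mv) (rule assms)

lemma DERIV_That:
  assumes "\<And>p. p \<in> grid B \<Longrightarrow> ((\<lambda>s. u s p) has_real_derivative u' p) (at t within T)"
  shows "((\<lambda>s. That B f (u s) q) has_real_derivative That B f u' q) (at t within T)"
  unfolding That_def 
  by (rule DERIV_sum, rule DERIV_sum, rule DERIV_cmult, rule DERIV_mv, rule DERIV_mv, rule assms)

text \<open>The variation of \<open>T\<close> multiplies \<open>w\<close> alone, whereas both parts of \<open>T w + 1/2 x w\<^sup>2\<close>
  contribute to the factor of \<open>w'\<close>, where they combine to the penalized traction
  \<open>\<tau> = T + x w\<close>.\<close>

lemma DERIV_face_energy:
  assumes B: "valid_block B" and f: "f \<in> faces B"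
    and u: "\<And>p. p \<in> grid B \<Longrightarrow> ((\<lambda>s. u s p) has_real_derivative u' p) (at t within T)"
    and us: "\<And>q. q \<in> face B f \<Longrightarrow>
      ((\<lambda>s. us s f q) has_real_derivative us' f q) (at t within T)"
  shows "((\<lambda>s. 1/2 * (let XinvH = mm (face B f) (mat_inverse (face B f) (Xf B f)) (Hf B f);
             \<tau> = tauhat B f (u s) (us s); T = That B f (u s)
         in dot (face B f) \<tau> (mv (face B f) XinvH \<tau>)
            - dot (face B f) T (mv (face B f) XinvH T))) has_real_derivative
      dot (face B f) (That B f u') (mv (face B f) (Hf B f) (\<lambda>r. us t f r - uf B f (u t) r))
      + dot (face B f) (tauhat B f (u t) (us t))
          (mv (face B f) (Hf B f) (\<lambda>q. us' f q - uf B f u' q))) (at t within T)"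
    (is "(?E has_real_derivative ?D) _")
proof -
  define w where "w s q = us s f q - uf B f (u s) q" for s q
  define w' where "w' q = us' f q - uf B f u' q" for q
  have w: "((\<lambda>s. w s q) has_real_derivative w' q) (at t within T)" if "q \<in> face B f" for q
    unfolding w_def w'_def by (intro DERIV_diff us DERIV_uf u that)
  have "?E = (\<lambda>s. \<Sum>q\<in>face B f. Hf B f q q *
      (That B f (u s) q * w s q + 1/2 * (Xf B f q q * (w s q)\<^sup>2)))"
    unfolding Let_def face_energy_eq[OF B f] w_def[symmetric] sum_distrib_left
    by (intro ext sum.cong refl) (simp add: field_simps)
  moreover have "((\<lambda>s. \<Sum>q\<in>face B f. Hf B f q q *
      (That B f (u s) q * w s q + 1/2 * (Xf B f q q * (w s q)\<^sup>2))) has_real_derivative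
    (\<Sum>q\<in>face B f. Hf B f q q *
      (That B f u' q * w t q + That B f (u t) q * w' q + Xf B f q q * w t q * w' q)))
    (at t within T)"
    by (rule DERIV_sum)
       (auto intro!: derivative_eq_intros DERIV_That[OF u] w simp: algebra_simps)
  moreover have "(\<Sum>q\<in>face B f. Hf B f q q *
      (That B f u' q * w t q + That B f (u t) q * w' q + Xf B f q q * w t q * w' q)) = ?D"
    unfolding w_def[symmetric] w'_def[symmetric] dot_def sum.distrib[symmetric]
    by (intro sum.cong refl)
       (simp add: mv_diagonal is_diagonal_Hf[OF B] tauhat_eq[OF f] algebra_simps
          flip: w_def)
  ultimately show ?thesis by simp
qed

section \<open>The energy rate\<close>

theorem corollary3:
  fixes B :: block
    and T :: "real set"
    and u du ddu :: "real \<Rightarrow> point \<Rightarrow> real"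
    and taus us dus :: "real \<Rightarrow> nat \<Rightarrow> point \<Rightarrow> real"
  assumes "valid_block B"
    and "is_interval T" and "interior T \<noteq> {}"
    and "\<And>t p. t \<in> T \<Longrightarrow> p \<in> grid B \<Longrightarrow>
           ((\<lambda>s. u s p) has_real_derivative du t p) (at t within T)"
    and "\<And>t p. t \<in> T \<Longrightarrow> p \<in> grid B \<Longrightarrow>
           ((\<lambda>s. du s p) has_real_derivative ddu t p) (at t within T)"
    and "\<And>t f q. t \<in> T \<Longrightarrow> f \<in> faces B \<Longrightarrow> q \<in> face B f \<Longrightarrow>
           ((\<lambda>s. us s f q) has_real_derivative dus t f q) (at t within T)"
    and "\<And>t. t \<in> T \<Longrightarrow> semidiscretization B (u t) (ddu t) (taus t) (us t)"
  shows "\<And>t. t \<in> T \<Longrightarrow>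
           ((\<lambda>s. block_energy B (u s) (du s) (us s)) has_real_derivative
             (\<Sum>f\<in>faces B. face_energy_rate B f (u t) (du t) (taus t) (us t) (dus t)))
           (at t within T)"
proof -
  note B = assms(1) and u = assms(4) and du = assms(5) and us = assms(6) and semi = assms(7)
  fix t assume t: "t \<in> T"
  let ?M = "mm (grid B) (Ht B) (Rho B)"
  let ?w = "\<lambda>f r. us t f r - uf B f (u t) r"
  have "is_symmetric (grid B) ?M"
    using is_diagonal_mass[OF B] unfolding is_diagonal_def is_symmetric_def by metis
  note kinetic = DERIV_quadratic_form[OF du[OF t] this]
  note elastic = DERIV_quadratic_form[OF u[OF t] is_symmetric_stiffness[OF B]]
  note face = DERIV_face_energy[OF B _ u[OF t] us[OF t]]
  have "((\<lambda>s. block_energy B (u s) (du s) (us s)) has_real_derivative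
      dot (grid B) (ddu t) (mv (grid B) ?M (du t))
      + dot (grid B) (du t) (mv (grid B) (stiffness B) (u t))
      + (\<Sum>f\<in>faces B.
          dot (face B f) (That B f (du t)) (mv (face B f) (Hf B f) (?w f))
          + dot (face B f) (tauhat B f (u t) (us t))
              (mv (face B f) (Hf B f) (\<lambda>q. dus t f q - uf B f (du t) q)))) (at t within T)"
    unfolding block_energy_def dot_mv_stiffness[symmetric] sum_distrib_left
  proof (rule DERIV_add[OF DERIV_add DERIV_sum])
    show "((\<lambda>s. 1/2 * dot (grid B) (du s) (mv (grid B) ?M (du s))) has_real_derivative
        dot (grid B) (ddu t) (mv (grid B) ?M (du t))) (at t within T)"
      by (rule kinetic)
    show "((\<lambda>s. 1/2 * dot (grid B) (u s) (mv (grid B) (stiffness B) (u s))) has_real_derivative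
        dot (grid B) (du t) (mv (grid B) (stiffness B) (u t))) (at t within T)"
      by (rule elastic)
  qed (rule face)
  moreover have "dot (grid B) (ddu t) (mv (grid B) ?M (du t))
      = dot (grid B) (du t) (mv (grid B) ?M (ddu t))"
    by (rule dot_mv_symmetric) fact
  ultimately show "((\<lambda>s. block_energy B (u s) (du s) (us s)) has_real_derivative
      (\<Sum>f\<in>faces B. face_energy_rate B f (u t) (du t) (taus t) (us t) (dus t))) (at t within T)"
    using semidiscretization_weak_form[OF B semi[OF t], of "du t"]
    by (simp add: face_energy_rate_def sum.distrib add.assoc[symmetric])
qed

end
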